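(* For every graph $G$ with at least one edge, $\operatorname{diam}(\mathcal{I}(G)) \leq 2\Delta(G) - 1$.
   Context: Graphs are finite and simple; $\Delta(G)$ is the maximum degree of $G$. In an orientation $\vec{G}$ of a graph $G$, the inversion of a set $X \subseteq V(G)$ consists in reversing all arcs with both endvertices in $X$. The inversion graph $\mathcal{I}(G)$ is the graph whose vertices are the labelled orientations of $G$, two orientations being adjacent if and only if the inversion of some $X\subseteq V(G)$ transforms one into the other; $\operatorname{diam}(\mathcal{I}(G))$ is its diameter. *)

theory Defs
  imports "Graph_Theory.Graph_Theory"
begin

text \<open>
  As everywhere in \<open>Graph_Theory\<close>, a finite simple graph is a finite loop-free symmetric
  digraph without parallel arcs (\<^locale>\<open>pair_graph\<close>): an edge \<open>uv\<close> is the pair of arcs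
  \<open>(u, v)\<close>, \<open>(v, u)\<close>, so the degree of a vertex is its out-degree.
\<close>

definition max_degree :: "'a pair_pre_digraph \<Rightarrow> nat" where
  "max_degree G = Max (out_degree (with_proj G) ` pverts G)"

text \<open>
  The length of a walk is its cost for unit weights. The distance is \<open>\<infinity>\<close> if there is no walk.
\<close>

definition distance :: "'a pair_pre_digraph \<Rightarrow> 'a \<Rightarrow> 'a \<Rightarrow> ereal" where
  "distance G u v = wf_digraph.\<mu> (with_proj G) (\<lambda>_. 1) u v"

definition diameter :: "'a pair_pre_digraph \<Rightarrow> ereal" where
  "diameter G = (SUP u\<in>pverts G. SUP v\<in>pverts G. distance G u v)"

text \<open>
  An orientation of \<open>G\<close> keeps exactly one of the two arcs of each edge. Orientations are
  labelled: they are distinguished by their arc sets, not up to isomorphism.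
\<close>

definition orientations :: "'a pair_pre_digraph \<Rightarrow> 'a pair_pre_digraph set" where
  "orientations G = {D. pverts D = pverts G \<and> parcs D \<subseteq> parcs G \<and>
     (\<forall>(u, v) \<in> parcs G. (u, v) \<in> parcs D \<longleftrightarrow> (v, u) \<notin> parcs D)}"

definition inversion :: "'a set \<Rightarrow> 'a pair_pre_digraph \<Rightarrow> 'a pair_pre_digraph" where
  "inversion X D = D\<lparr>parcs := {(u, v). if u \<in> X \<and> v \<in> X then (v, u) \<in> parcs D
                                                         else (u, v) \<in> parcs D}\<rparr>"

text \<open>
  Inverting a set that spans no edge changes nothing; the condition \<open>D \<noteq> D'\<close> excludes the
  resulting loops, so that the inversion graph is simple. Loops do not affect distances.
\<close>

definition inversion_graph :: "'a pair_pre_digraph \<Rightarrow> 'a pair_pre_digraph pair_pre_digraph" where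
  "inversion_graph G = \<lparr>pverts = orientations G,
     parcs = {(D, D'). D \<in> orientations G \<and> D' \<in> orientations G \<and> D \<noteq> D' \<and>
                       (\<exists>X\<subseteq>pverts G. D' = inversion X D)}\<rparr>"

lemma inversion_inversion: "inversion X (inversion X D) = D"
  by (rule pair_pre_digraph.equality) (auto simp: inversion_def split: if_splits)

lemma pair_graph_inversion_graph:
  assumes "pair_graph G"
  shows "pair_graph (inversion_graph G)"
proof -
  interpret pair_graph G by fact
  have "orientations G \<subseteq> (\<lambda>A. \<lparr>pverts = pverts G, parcs = A\<rparr>) ` Pow (parcs G)"
  proof
    fix D assume "D \<in> orientations G"
    then show "D \<in> (\<lambda>A. \<lparr>pverts = pverts G, parcs = A\<rparr>) ` Pow (parcs G)"
      by (intro image_eqI[of _ _ "parcs D"]) (auto simp: orientations_def)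
  qed
  then have fin: "finite (orientations G)"
    by (rule finite_subset) (simp add: pair_finite_arcs)
  have "parcs (inversion_graph G) \<subseteq> orientations G \<times> orientations G"
    by (auto simp: inversion_graph_def)
  then have "finite (parcs (inversion_graph G))"
    using fin by (auto intro: finite_subset)
  moreover have "sym (parcs (inversion_graph G))"
    proof (rule symI)
    fix D D' assume "(D, D') \<in> parcs (inversion_graph G)"
    then show "(D', D) \<in> parcs (inversion_graph G)"
      by (auto simp: inversion_graph_def intro: inversion_inversion[symmetric])
  qed
  ultimately show ?thesis
    using fin by unfold_locales (auto simp: inversion_graph_def symmetric_def)
qed

lemma distance_altdef:
  assumes "pair_wf_digraph G"
  shows "distance G u v =
    (INF p\<in>{p. pre_digraph.awalk (with_proj G) u p v}. ereal (real (length p)))"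
proof -
  interpret pair_wf_digraph G by fact
  have "awalk_cost (\<lambda>_. 1) p = real (length p)" for p
    by (induction p) auto
  then show ?thesis
    by (simp add: distance_def \<mu>_def)
qed

end

theory Submission
  imports Defs
begin

text \<open>
  Let \<open>F\<close> be the set of edges on which two orientations differ, and let \<open>k = 2 * \<Delta>(G) - 1\<close>.
  Inverting \<open>X\<^sub>1, \<dots>, X\<^sub>k\<close> in turn reverses \<open>uv\<close> according to the scalar product over the
  two-element field of the incidence vectors of \<open>u\<close> and \<open>v\<close> in these sets. So it suffices to give
  each vertex a vector such that adjacent vertices have product 1 exactly on \<open>F\<close>. This is done
  greedily, keeping the vectors of the processed neighbours of every unprocessed vertex linearly
  independent: a new vertex with \<open>d\<close> processed neighbours has \<open>2 ^ (k - d)\<close> admissible vectors, and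
  each of its at most \<open>\<Delta>(G) - d\<close> unprocessed neighbours forbids a span of at most
  \<open>2 ^ (\<Delta>(G) - 1)\<close> of them, fewer than \<open>2 ^ (k - d)\<close> in total.
\<close>

section \<open>Linear algebra over the two-element field\<close>

text \<open>
  A vector over the two-element field is represented by its support, so that addition is symmetric
  difference and the scalar product is the parity of the intersection.
\<close>

definition vec_sum :: "('a \<Rightarrow> 'b set) \<Rightarrow> 'a set \<Rightarrow> 'b set" where
  "vec_sum x T = {i. odd (card {u \<in> T. i \<in> x u})}"

text \<open>Scalars are 0 or 1, so linear combinations are sums over subsets. The notion concerns
  the indexed family, so a repeated vector makes it dependent.\<close>

definition vec_indep :: "('a \<Rightarrow> 'b set) \<Rightarrow> 'a set \<Rightarrow> bool" where
  "vec_indep x U \<longleftrightarrow> (\<forall>T\<subseteq>U. T \<noteq> {} \<longrightarrow> vec_sum x T \<noteq> {})"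

text \<open>The additive character of the scalar product: a sign recording its parity.\<close>

definition chi :: "'b set \<Rightarrow> 'b set \<Rightarrow> int" where
  "chi y z = (-1) ^ card (y \<inter> z)"

lemma chi_empty [simp]: "chi y {} = 1"
  by (simp add: chi_def)

lemma vec_sum_cong: "(\<And>u. u \<in> T \<Longrightarrow> x u = x' u) \<Longrightarrow> vec_sum x T = vec_sum x' T"
  unfolding vec_sum_def by (metis (mono_tags, lifting) Collect_cong)

lemma vec_indep_cong: "(\<And>u. u \<in> U \<Longrightarrow> x u = x' u) \<Longrightarrow> vec_indep x U = vec_indep x' U"
  unfolding vec_indep_def by (metis subsetD vec_sum_cong)

lemma vec_sum_empty [simp]: "vec_sum x {} = {}"
  by (simp add: vec_sum_def)

lemma vec_sum_subset:
  assumes "\<And>u. u \<in> T \<Longrightarrow> x u \<subseteq> K"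
  shows "vec_sum x T \<subseteq> K"
proof
  fix i assume "i \<in> vec_sum x T"
  then have "odd (card {u \<in> T. i \<in> x u})" by (simp add: vec_sum_def)
  then have "{u \<in> T. i \<in> x u} \<noteq> {}" by (rule odd_card_imp_not_empty)
  then show "i \<in> K" using assms by blast
qed

lemma vec_sum_insert:
  assumes "finite T" "u \<notin> T"
  shows "vec_sum x (insert u T) = sym_diff (x u) (vec_sum x T)"
proof -
  have "odd (card {v \<in> insert u T. i \<in> x v}) \<longleftrightarrow> (i \<in> x u) \<noteq> odd (card {v \<in> T. i \<in> x v})" for i
  proof (cases "i \<in> x u")
    case True
    then have "{v \<in> insert u T. i \<in> x v} = insert u {v \<in> T. i \<in> x v}" by auto
    then show ?thesis using assms True by simp
  next
    case False
    then have "{v \<in> insert u T. i \<in> x v} = {v \<in> T. i \<in> x v}" by auto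
    then show ?thesis using False by simp
  qed
  then show ?thesis by (auto simp: vec_sum_def)
qed

lemma vec_indep_insert:
  assumes fin: "finite U" and "v \<notin> U" and U: "vec_indep x U"
    and x: "x v \<notin> vec_sum x ` Pow U"
  shows "vec_indep x (insert v U)"
  unfolding vec_indep_def
proof (intro allI impI)
  fix T assume T: "T \<subseteq> insert v U" "T \<noteq> {}"
  show "vec_sum x T \<noteq> {}"
  proof (cases "v \<in> T")
    case True
    define T' where "T' = T - {v}"
    have T': "T = insert v T'" "v \<notin> T'" "T' \<subseteq> U" using True T by (auto simp: T'_def)
    then have "vec_sum x T = sym_diff (x v) (vec_sum x T')"
      using fin vec_sum_insert by (metis finite_subset)
    moreover have "x v \<noteq> vec_sum x T'" using x T' by blast
    ultimately show ?thesis by auto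
  next
    case False
    then show ?thesis using T U unfolding vec_indep_def by blast
  qed
qed

section \<open>Character sums and the number of solutions of a linear system\<close>

lemma chi_sym_diff:
  assumes "finite y"
  shows "chi y (sym_diff A B) = chi y A * chi y B"
proof -
  have A: "card (y \<inter> A) = card (y \<inter> (A - B)) + card (y \<inter> A \<inter> B)"
    using assms by (subst card_Un_disjoint[symmetric]) (auto intro!: arg_cong[of _ _ card])
  have B: "card (y \<inter> B) = card (y \<inter> (B - A)) + card (y \<inter> A \<inter> B)"
    using assms by (subst card_Un_disjoint[symmetric]) (auto intro!: arg_cong[of _ _ card])
  have C: "card (y \<inter> sym_diff A B) = card (y \<inter> (A - B)) + card (y \<inter> (B - A))"
    using assms by (subst card_Un_disjoint[symmetric]) (auto intro!: arg_cong[of _ _ card])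
  show ?thesis
    unfolding chi_def A B C by (simp add: power_add)
qed

lemma chi_vec_sum:
  assumes "finite T" "finite y"
  shows "chi y (vec_sum x T) = (\<Prod>u\<in>T. chi y (x u))"
  using assms(1)
  by induction (simp_all add: vec_sum_insert chi_sym_diff assms(2))

text \<open>Toggling a fixed coordinate \<open>i\<close> of \<open>z\<close> in \<open>y\<close> is
  an involution of \<open>Pow K\<close> that changes the sign of every summand.\<close>

lemma sum_chi_nonempty:
  assumes K: "finite K" and z: "z \<subseteq> K" "z \<noteq> {}"
  shows "(\<Sum>y\<in>Pow K. chi y z) = 0"
proof -
  obtain i where i: "i \<in> z" using z by blast
  have flip: "chi (sym_diff y {i}) z = - chi y z" if "y \<subseteq> K" for y
  proof -
    have "finite y" using that K finite_subset by blast
    have com: "chi a b = chi b a" for a b :: "'a set" by (simp add: chi_def Int_commute)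
    have "finite z" using z K finite_subset by blast
    then have "chi z (sym_diff y {i}) = chi z y * chi z {i}" by (rule chi_sym_diff)
    moreover have "chi z {i} = -1" using i by (simp add: chi_def)
    ultimately show ?thesis by (simp add: com)
  qed
  have invol: "sym_diff (sym_diff y {i}) {i} = y" for y by blast
  have "(\<Sum>y\<in>Pow K. chi y z) = (\<Sum>y\<in>Pow K. chi (sym_diff y {i}) z)"
    by (rule sum.reindex_bij_witness[where i="\<lambda>y. sym_diff y {i}" and j="\<lambda>y. sym_diff y {i}"])
       (use i z in \<open>simp_all only: invol, blast+\<close>)
  also have "\<dots> = - (\<Sum>y\<in>Pow K. chi y z)"
    by (simp add: flip sum_negf)
  finally show ?thesis by simp
qed

text \<open>
  Expanding \<open>\<Prod>u\<in>U. 1 + s u * chi y (x u)\<close> over the subsets \<open>T\<close> of \<open>U\<close> and summing over \<open>y\<close>, only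
  \<open>T = {}\<close> survives, as by independence every other \<open>vec_sum x T\<close> is nonzero.
\<close>

lemma card_solutions:
  fixes x :: "'a \<Rightarrow> 'b set"
  assumes K: "finite K" and U: "finite U" and x: "\<And>u. u \<in> U \<Longrightarrow> x u \<subseteq> K"
    and ind: "vec_indep x U"
  shows "2 ^ card U * card {y \<in> Pow K. \<forall>u\<in>U. odd (card (y \<inter> x u)) \<longleftrightarrow> b u} = 2 ^ card K"
    (is "_ * card ?S = _")
proof -
  define s :: "'a \<Rightarrow> int" where "s u = (if b u then -1 else 1)" for u
  \<comment> \<open>Each factor is 2 if \<open>y\<close> meets the constraint at \<open>u\<close>
    and 0 otherwise, so the product is a scaled indicator of the solution set.\<close>
  have prod: "(\<Prod>u\<in>U. s u * chi y (x u) + 1) = (if y \<in> ?S then 2 ^ card U else 0)"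
    if y: "y \<in> Pow K" for y
  proof (cases "y \<in> ?S")
    case True
    then have "s u * chi y (x u) + 1 = 2" if "u \<in> U" for u
      using that by (auto simp: s_def chi_def minus_one_power_iff)
    then show ?thesis using True by simp
  next
    case False
    then obtain u where "u \<in> U" "\<not> (odd (card (y \<inter> x u)) \<longleftrightarrow> b u)" using y by blast
    then have "s u * chi y (x u) + 1 = 0"
      by (auto simp: s_def chi_def minus_one_power_iff)
    then show ?thesis using False U \<open>u \<in> U\<close> by (auto intro: prod_zero)
  qed
  have "(2::int) ^ card U * int (card ?S) = (\<Sum>y\<in>Pow K. if y \<in> ?S then 2 ^ card U else 0)"
    using K by (subst sum.inter_restrict[symmetric]) (auto simp: Int_def mult.commute)
  also have "\<dots> = (\<Sum>y\<in>Pow K. \<Prod>u\<in>U. s u * chi y (x u) + 1)"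
    by (intro sum.cong) (simp_all only: prod)
  also have "\<dots> = (\<Sum>y\<in>Pow K. \<Sum>T\<in>Pow U. (\<Prod>u\<in>T. s u) * chi y (vec_sum x T))"
  proof (rule sum.cong[OF refl])
    fix y assume "y \<in> Pow K"
    then have "finite y" using K finite_subset by blast
    then show "(\<Prod>u\<in>U. s u * chi y (x u) + 1) = (\<Sum>T\<in>Pow U. (\<Prod>u\<in>T. s u) * chi y (vec_sum x T))"
      using U finite_subset[OF _ U]
      by (subst prod_add) (auto intro!: sum.cong simp: prod.distrib chi_vec_sum)
  qed
  also have "\<dots> = (\<Sum>T\<in>Pow U. (\<Prod>u\<in>T. s u) * (\<Sum>y\<in>Pow K. chi y (vec_sum x T)))"
    by (subst sum.swap) (simp add: sum_distrib_left)
  also have "\<dots> = (\<Sum>T\<in>Pow U. if T = {} then 2 ^ card K else 0)"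
  proof (rule sum.cong[OF refl])
    fix T assume T: "T \<in> Pow U"
    show "(\<Prod>u\<in>T. s u) * (\<Sum>y\<in>Pow K. chi y (vec_sum x T)) = (if T = {} then 2 ^ card K else 0)"
    proof (cases "T = {}")
      case True
      then show ?thesis by (simp add: card_Pow K)
    next
      case False
      have "vec_sum x T \<subseteq> K" using x T by (intro vec_sum_subset) auto
      moreover have "vec_sum x T \<noteq> {}" using False T ind by (auto simp: vec_indep_def)
      ultimately show ?thesis using False by (simp add: sum_chi_nonempty K)
    qed
  qed
  also have "\<dots> = 2 ^ card K"
    using U by (simp add: sum.delta)
  finally have "int (2 ^ card U * card ?S) = int (2 ^ card K)" by simp
  then show ?thesis by (simp only: of_nat_eq_iff)
qed

section \<open>Greedy choice of the vectors\<close>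

text \<open>Induction on the set \<open>S\<close> of processed vertices. The last conjunct is the
  invariant by which the linear system for the next vertex has independent rows.\<close>

lemma ex_vector_assignment:
  fixes E :: "('a \<times> 'a) set"
  assumes S: "finite S" and sym: "sym E" "irrefl E"
    and fin: "\<And>v. finite (E `` {v})" and deg: "\<And>v. card (E `` {v}) \<le> d" and d: "d > 0"
    and K: "finite K" "card K = 2 * d - 1"
    and b: "\<And>u v. b u v \<longleftrightarrow> b v u"
  shows "\<exists>x. (\<forall>v. x v \<subseteq> K) \<and>
    (\<forall>u\<in>S. \<forall>v\<in>S. (u, v) \<in> E \<longrightarrow> (odd (card (x u \<inter> x v)) \<longleftrightarrow> b u v)) \<and>
    (\<forall>w. w \<notin> S \<longrightarrow> vec_indep x (E `` {w} \<inter> S))"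
  using S
proof induction
  case empty
  show ?case by (rule exI[of _ "\<lambda>_. {}"]) (auto simp: vec_indep_def)
next
  case (insert v S)
  then obtain x where x: "\<And>v. x v \<subseteq> K"
    and dot: "\<And>u v. u \<in> S \<Longrightarrow> v \<in> S \<Longrightarrow> (u, v) \<in> E \<Longrightarrow> (odd (card (x u \<inter> x v)) \<longleftrightarrow> b u v)"
    and ind: "\<And>w. w \<notin> S \<Longrightarrow> vec_indep x (E `` {w} \<inter> S)"
    by blast
  define U where "U = E `` {v} \<inter> S"
  define W where "W = E `` {v} - S"
  \<comment> \<open>\<open>Sol\<close> holds the admissible vectors for \<open>v\<close>;
    \<open>Bad\<close> is the union of the spans that would break the invariant at some unprocessed
    neighbour of \<open>v\<close>.\<close>
  define Sol where "Sol = {y \<in> Pow K. \<forall>u\<in>U. odd (card (y \<inter> x u)) \<longleftrightarrow> b v u}"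
  define Bad where "Bad = (\<Union>w\<in>W. vec_sum x ` Pow (E `` {w} \<inter> S))"
  have "finite U" "finite W" using fin by (auto simp: U_def W_def)
  have UW: "card U + card W \<le> d"
  proof -
    have "card U + card W = card (E `` {v})"
      unfolding U_def W_def using fin
      by (subst card_Un_disjoint[symmetric]) (auto intro!: arg_cong[of _ _ card])
    then show ?thesis using deg by metis
  qed
  have "2 ^ card U * card Sol = 2 ^ card K"
    unfolding Sol_def using K \<open>finite U\<close> x ind[OF insert(2)] by (intro card_solutions) (auto simp: U_def)
  have "card (vec_sum x ` Pow (E `` {w} \<inter> S)) \<le> 2 ^ (d - 1)" if "w \<in> W" for w
  proof -
    \<comment> \<open>As \<open>v\<close> is a neighbour of \<open>w\<close> outside
      \<open>S\<close>, at most \<open>d - 1\<close> neighbours of \<open>w\<close> lie in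
      \<open>S\<close>.\<close>
    have "v \<in> E `` {w}" using that sym by (auto simp: W_def sym_def)
    then have "E `` {w} \<inter> S \<subset> E `` {w}" using insert by blast
    then have "card (E `` {w} \<inter> S) < d" using fin deg psubset_card_mono by (metis order_less_le_trans)
    then have "card (Pow (E `` {w} \<inter> S)) \<le> 2 ^ (d - 1)" using fin by (subst card_Pow) auto
    then show ?thesis using fin card_image_le by (metis finite_Int finite_Pow_iff le_trans)
  qed
  then have "(\<Sum>w\<in>W. card (vec_sum x ` Pow (E `` {w} \<inter> S))) \<le> of_nat (card W) * 2 ^ (d - 1)"
    by (rule sum_bounded_above)
  then have "card Bad \<le> card W * 2 ^ (d - 1)"
    unfolding Bad_def using card_UN_le[OF \<open>finite W\<close>] by (simp only: of_nat_id) (rule order_trans)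
  \<comment> \<open>Strictness comes from \<open>m < 2 ^ m\<close>, valid also for
    \<open>m = 0\<close>.\<close>
  also have "\<dots> < 2 ^ card W * 2 ^ (d - 1)" by simp
  finally have "2 ^ card U * card Bad < 2 ^ card U * (2 ^ card W * 2 ^ (d - 1))" by simp
  also have "\<dots> = 2 ^ (card U + card W + (d - 1))" by (simp add: power_add)
  \<comment> \<open>The dimension \<open>2 * d - 1\<close> arises here, as \<open>d\<close> for the
    neighbours of \<open>v\<close> plus \<open>d - 1\<close> for one span.\<close>
  also have "\<dots> \<le> 2 ^ card K" using UW K d by (intro power_increasing) auto
  also note \<open>2 ^ card U * card Sol = 2 ^ card K\<close>[symmetric]
  finally have "card Bad < card Sol" by simp
  moreover have "finite Bad" unfolding Bad_def using fin \<open>finite W\<close> by auto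
  ultimately have "\<not> Sol \<subseteq> Bad" using card_mono by (metis leD)
  then obtain y where y: "y \<in> Sol" "y \<notin> Bad" by blast
  define x' where "x' = x(v := y)"
  have x'_S: "x' u = x u" if "u \<in> S" for u using that insert by (auto simp: x'_def)
  have "x' u \<subseteq> K" for u using x y by (auto simp: x'_def Sol_def)
  moreover have "odd (card (x' u \<inter> x' w)) \<longleftrightarrow> b u w"
    if uw: "u \<in> insert v S" "w \<in> insert v S" "(u, w) \<in> E" for u w
  proof -
    have y_dot: "odd (card (y \<inter> x u)) \<longleftrightarrow> b v u" if "(v, u) \<in> E" "u \<in> S" for u
      using that y by (auto simp: Sol_def U_def)
    \<comment> \<open>Irreflexivity excludes \<open>u = w = v\<close>.\<close>
    consider "u \<in> S" "w \<in> S" | "u = v" "w \<in> S" | "u \<in> S" "w = v" "(v, u) \<in> E"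
      using uw sym by (auto simp: sym_def irrefl_def)
    then show ?thesis
    proof cases
      case 1 then show ?thesis using dot uw x'_S by simp
    next
      case 2 then show ?thesis using y_dot uw x'_S by (simp add: x'_def)
    next
      case 3 then show ?thesis using y_dot x'_S b[of u v] by (simp add: x'_def Int_commute)
    qed
  qed
  moreover have "vec_indep x' (E `` {w} \<inter> insert v S)" if w: "w \<notin> insert v S" for w
  proof -
    have *: "vec_indep x' (E `` {w} \<inter> S)"
      using ind[of w] w vec_indep_cong[of "E `` {w} \<inter> S" x' x] x'_S by auto
    show ?thesis
    proof (cases "v \<in> E `` {w}")
      case True
      then have "w \<in> W" using w sym by (auto simp: W_def sym_def)
      then have "y \<notin> vec_sum x ` Pow (E `` {w} \<inter> S)" using y by (auto simp: Bad_def)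
      moreover have "vec_sum x ` Pow (E `` {w} \<inter> S) = vec_sum x' ` Pow (E `` {w} \<inter> S)"
        using x'_S by (intro image_cong refl vec_sum_cong) auto
      ultimately have "vec_indep x' (insert v (E `` {w} \<inter> S))"
        using * insert fin by (intro vec_indep_insert) (auto simp: x'_def)
      moreover have "E `` {w} \<inter> insert v S = insert v (E `` {w} \<inter> S)" using True by blast
      ultimately show ?thesis by simp
    next
      case False
      then have "E `` {w} \<inter> insert v S = E `` {w} \<inter> S" by blast
      then show ?thesis using * by simp
    qed
  qed
  ultimately show ?case by blast
qed

section \<open>Orientations and successive inversions\<close>

lemma orientation_arcD: "D \<in> orientations G \<Longrightarrow> (u, v) \<in> parcs D \<Longrightarrow> (u, v) \<in> parcs G"
  by (auto simp: orientations_def)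

lemma orientation_arc_iff:
  "D \<in> orientations G \<Longrightarrow> (u, v) \<in> parcs G \<Longrightarrow> (u, v) \<in> parcs D \<longleftrightarrow> (v, u) \<notin> parcs D"
  unfolding orientations_def by blast

lemma arc_inversion_iff:
  "(u, v) \<in> parcs (inversion X D) \<longleftrightarrow>
    (if u \<in> X \<and> v \<in> X then (v, u) \<in> parcs D else (u, v) \<in> parcs D)"
  by (simp add: inversion_def)

lemma pverts_inversion [simp]: "pverts (inversion X D) = pverts D"
  by (simp add: inversion_def)

text \<open>The condition for reversal is symmetric in \<open>u\<close> and \<open>v\<close>, so
  both arcs of an edge are exchanged together.\<close>

lemma inversion_in_orientations:
  assumes "pair_graph G" and D: "D \<in> orientations G"
  shows "inversion X D \<in> orientations G"
proof -
  interpret pair_graph G by fact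
  have "(u, v) \<in> parcs G" if "(u, v) \<in> parcs (inversion X D)" for u v
    using that orientation_arcD[OF D, of u v] orientation_arcD[OF D, of v u] arcs_symmetric[of v u]
    unfolding arc_inversion_iff by (metis (full_types))
  moreover have "(u, v) \<in> parcs (inversion X D) \<longleftrightarrow> (v, u) \<notin> parcs (inversion X D)"
    if "(u, v) \<in> parcs G" for u v
    using orientation_arc_iff[OF D that] unfolding arc_inversion_iff by (metis (full_types))
  ultimately show ?thesis
    using D unfolding orientations_def by (simp add: subset_iff) blast
qed

text \<open>Here \<open>x v\<close> is the incidence vector of \<open>v\<close>: coordinate
  \<open>i\<close> tells whether \<open>v\<close> lies in the set inverted in round
  \<open>i\<close>, counted from 0.\<close>

fun invert_upto :: "('a \<Rightarrow> nat set) \<Rightarrow> nat \<Rightarrow> 'a pair_pre_digraph \<Rightarrow> 'a pair_pre_digraph" where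
  "invert_upto x 0 D = D"
| "invert_upto x (Suc n) D = inversion {v \<in> pverts D. n \<in> x v} (invert_upto x n D)"

lemma pverts_invert_upto [simp]: "pverts (invert_upto x n D) = pverts D"
  by (induction n) simp_all

text \<open>Round \<open>i\<close> reverses \<open>uv\<close> exactly if \<open>i\<close> lies in
  both vectors, and two reversals cancel.\<close>

lemma arc_invert_upto:
  assumes "u \<in> pverts D" "v \<in> pverts D"
  shows "(u, v) \<in> parcs (invert_upto x n D) \<longleftrightarrow>
    (if odd (card (x u \<inter> x v \<inter> {..<n})) then (v, u) \<in> parcs D else (u, v) \<in> parcs D)"
  using assms
proof (induction n arbitrary: u v)
  case (Suc n)
  have "card (x u \<inter> x v \<inter> {..<Suc n}) =
    (if n \<in> x u \<and> n \<in> x v then Suc (card (x u \<inter> x v \<inter> {..<n})) else card (x u \<inter> x v \<inter> {..<n}))"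
    by (auto simp: lessThan_Suc)
  \<comment> \<open>The induction hypothesis is applied to \<open>(v, u)\<close> as well, with the
    same intersection.\<close>
  moreover have "x v \<inter> x u = x u \<inter> x v" by blast
  ultimately show ?case
    using Suc by (simp add: arc_inversion_iff)
qed simp

text \<open>The length is only bounded by \<open>n\<close>: the inversion graph has no loops, so a
  round that changes nothing adds no arc to the walk.\<close>

lemma awalk_invert_upto:
  assumes G: "pair_graph G" and D: "D \<in> orientations G"
  shows "invert_upto x n D \<in> orientations G \<and>
    (\<exists>p. pre_digraph.awalk (with_proj (inversion_graph G)) D p (invert_upto x n D) \<and> length p \<le> n)"
proof (induction n)
  interpret I: pair_graph "inversion_graph G" using G by (rule pair_graph_inversion_graph)
  case 0
  have "pverts (inversion_graph G) = orientations G" by (simp add: inversion_graph_def)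
  then have "I.awalk D [] D" using D by (simp only: I.awalk_Nil_iff with_proj_simps)
  then show ?case using D by auto
next
  interpret I: pair_graph "inversion_graph G" using G by (rule pair_graph_inversion_graph)
  case (Suc n)
  let ?A = "invert_upto x n D" and ?B = "invert_upto x (Suc n) D"
  obtain p where p: "I.awalk D p ?A" "length p \<le> n" using Suc by blast
  have B: "?B \<in> orientations G" using Suc inversion_in_orientations[OF G] by simp
  show ?case
  proof (cases "?B = ?A")
    case True
    then show ?thesis using p B by (metis le_SucI)
  next
    case False
    have "pverts D = pverts G" using D by (simp add: orientations_def)
    then have "\<exists>X\<subseteq>pverts G. ?B = inversion X ?A"
      by (intro exI[of _ "{v \<in> pverts G. n \<in> x v}"]) auto
    then have "(?A, ?B) \<in> parcs (inversion_graph G)"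
      using False B conjunct1[OF Suc] unfolding inversion_graph_def by simp
    then have "I.awalk ?A [(?A, ?B)] ?B" 
      using I.arc_implies_awalk[of "(?A, ?B)"] by (simp only: with_proj_simps fst_conv snd_conv)
    with p(1) have "I.awalk D (p @ [(?A, ?B)]) ?B" by (rule I.awalk_appendI)
    moreover have "length (p @ [(?A, ?B)]) \<le> Suc n" using p(2) by simp
    ultimately show ?thesis using B by blast
  qed
qed

section \<open>The bound on distances and on the diameter\<close>

lemma distance_orientations_le:
  assumes G: "pair_graph G" and ne: "parcs G \<noteq> {}"
    and D: "D \<in> orientations G" and D': "D' \<in> orientations G"
  shows "distance (inversion_graph G) D D' \<le> ereal (2 * real (max_degree G) - 1)"
proof -
  interpret pair_graph G by fact
  interpret I: pair_graph "inversion_graph G" using G by (rule pair_graph_inversion_graph)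
  have symG: "(v, u) \<in> parcs G" if "(u, v) \<in> parcs G" for u v
    using that by (rule arcs_symmetric)
  have nbr: "parcs G `` {v} \<subseteq> pverts G" for v using in_arcsD2 by auto
  let ?d = "max_degree G" and ?k = "2 * max_degree G - 1"
  have fin: "finite (parcs G `` {v})" for v using nbr finite_subset pair_finite_verts by blast
  have deg: "card (parcs G `` {v}) \<le> ?d" for v
  proof (cases "v \<in> pverts G")
    case True
    have "out_arcs (with_proj G) v = Pair v ` (parcs G `` {v})"
      by (auto simp: out_arcs_def)
    then have "card (parcs G `` {v}) = out_degree (with_proj G) v"
      by (simp add: out_degree_def card_image inj_on_def)
    then show ?thesis using True by (simp add: max_degree_def)
  next
    \<comment> \<open>The degree bound of \<open>ex_vector_assignment\<close> ranges over the whole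
      type; a non-vertex has no neighbours.\<close>
    case False
    then have "parcs G `` {v} = {}" using in_arcsD1 by auto
    then show ?thesis by simp
  qed
  obtain u0 v0 where "(u0, v0) \<in> parcs G" using ne by auto
  then have "card (parcs G `` {u0}) > 0" using fin by (auto simp: card_gt_0_iff)
  \<comment> \<open>Positivity also ensures that \<open>2 * ?d - 1\<close> on naturals agrees with
    its real counterpart in the final bound.\<close>
  then have d: "?d > 0" using deg order_less_le_trans by blast
  \<comment> \<open>On an edge both disjuncts say that \<open>D\<close> and \<open>D'\<close> differ
    there; joining them makes \<open>b\<close> symmetric by its form, for all pairs.\<close>
  define b where "b u v \<longleftrightarrow> (((u, v) \<in> parcs D \<longleftrightarrow> (u, v) \<notin> parcs D')
      \<or> ((v, u) \<in> parcs D \<longleftrightarrow> (v, u) \<notin> parcs D'))" for u v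
  have "sym (parcs G)" using symG by (rule symI)
  moreover have "irrefl (parcs G)" using no_loops' by (blast intro: irreflI)
  moreover have "b u v \<longleftrightarrow> b v u" for u v unfolding b_def by blast
  ultimately have "\<exists>x. (\<forall>v. x v \<subseteq> {..<?k}) \<and>
    (\<forall>u\<in>pverts G. \<forall>v\<in>pverts G. (u, v) \<in> parcs G \<longrightarrow> (odd (card (x u \<inter> x v)) \<longleftrightarrow> b u v)) \<and>
    (\<forall>w. w \<notin> pverts G \<longrightarrow> vec_indep x (parcs G `` {w} \<inter> pverts G))"
    using fin deg d pair_finite_verts by (intro ex_vector_assignment) simp_all
  then obtain x where x: "\<And>v. x v \<subseteq> {..<?k}"
    and dot: "\<And>u v. u \<in> pverts G \<Longrightarrow> v \<in> pverts G \<Longrightarrow> (u, v) \<in> parcs G \<Longrightarrow>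
      odd (card (x u \<inter> x v)) \<longleftrightarrow> b u v"
    by blast
  have vD: "pverts D = pverts G" "pverts D' = pverts G" using D D' by (auto simp: orientations_def)
  have C: "invert_upto x ?k D \<in> orientations G" using awalk_invert_upto[OF G D] by blast
  have "(u, v) \<in> parcs (invert_upto x ?k D) \<longleftrightarrow> (u, v) \<in> parcs D'" for u v
  proof (cases "(u, v) \<in> parcs G")
    case True
    then have uv: "u \<in> pverts G" "v \<in> pverts G" using in_arcsD1 in_arcsD2 by auto
    \<comment> \<open>All coordinates lie below \<open>?k\<close>, so after \<open>?k\<close> rounds
      the full scalar product has taken effect.\<close>
    have "x u \<inter> x v \<inter> {..<?k} = x u \<inter> x v" using x by blast
    then have "(u, v) \<in> parcs (invert_upto x ?k D) \<longleftrightarrow>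
        (if b u v then (v, u) \<in> parcs D else (u, v) \<in> parcs D)"
      using arc_invert_upto[of u D v x ?k] uv vD dot[OF uv True] by simp
    then show ?thesis
      using orientation_arc_iff[OF D True] orientation_arc_iff[OF D' True]
      unfolding b_def by (metis (full_types))
  next
    case False
    then show ?thesis using orientation_arcD C D' by metis
  qed
  then have "invert_upto x ?k D = D'"
    by (intro pair_pre_digraph.equality) (auto simp: vD)
  then obtain p where p: "I.awalk D p D'" "length p \<le> ?k"
    using awalk_invert_upto[OF G D] by metis
  have "distance (inversion_graph G) D D' \<le> ereal (real (length p))"
    unfolding distance_altdef[OF I.pair_wf_digraph_axioms] using p by (auto intro: INF_lower)
  also have "\<dots> \<le> ereal (2 * real (max_degree G) - 1)"
    using p d by simp
  finally show ?thesis .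
qed

theorem theorem6p2:
  fixes G :: "'a pair_pre_digraph"
  assumes "pair_graph G"
    and "parcs G \<noteq> {}"
  shows "diameter (inversion_graph G) \<le> ereal (2 * real (max_degree G) - 1)"
  unfolding diameter_def
  using distance_orientations_le[OF assms]
  by (intro SUP_least) (auto simp: inversion_graph_def)

end
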